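(* For $n\ge 0$ let $A_{0,n}$ be the total number of leaves in all labeled non-plane 1-2 trees on vertex set $[n]$ (so $A_{0,0}=0$), and let $A_0(z)=\sum_{n\ge0}A_{0,n}\frac{z^n}{n!}$. Then \[A_0(z)=\frac{z-1+\cos z}{1-\sin z}.\]
   Context: A labeled non-plane 1-2 tree on vertex set $[n]=\{1,\dots,n\}$ is a rooted tree whose vertices are bijectively labeled by $[n]$, in which every vertex has at most two children, the label of each non-root vertex is less than the label of its parent, and the children of a vertex are unordered. A leaf is a vertex with no children. *)

theory Defs
  imports Complex_Main "HOL-Computational_Algebra.Formal_Power_Series"
begin

text \<open>A rooted tree is represented by its root and the set \<open>E\<close> of its edges, directed from
  parent to child; the children of \<open>v\<close> form the set \<open>E `` {v}\<close> and so carry no order.\<close>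

definition rooted_tree :: "'a set \<Rightarrow> 'a \<Rightarrow> ('a \<times> 'a) set \<Rightarrow> bool" where
  "rooted_tree V r E \<longleftrightarrow>
     finite V \<and> r \<in> V \<and> E \<subseteq> V \<times> V \<and>
     (\<forall>u. (u, r) \<notin> E) \<and>
     (\<forall>v\<in>V - {r}. \<exists>!u. (u, v) \<in> E) \<and>
     (\<forall>v\<in>V. (r, v) \<in> E\<^sup>*)"

text \<open>A labeling by \<open>{1..n}\<close> is rendered by taking \<open>{1..n}\<close> itself as the vertex set, so distinct
  labeled trees are distinct pairs of a root and an edge set. As the root must be a
  vertex, there is no tree for \<open>n = 0\<close>.\<close>

definition trees12 :: "nat \<Rightarrow> (nat \<times> (nat \<times> nat) set) set" where
  "trees12 n = {(r, E). rooted_tree {1..n} r E \<and>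
     (\<forall>v\<in>{1..n}. card (E `` {v}) \<le> 2) \<and>
     (\<forall>(u, v)\<in>E. v < u)}"

definition leaves :: "'a set \<Rightarrow> ('a \<times> 'a) set \<Rightarrow> 'a set" where
  "leaves V E = {v \<in> V. E `` {v} = {}}"

definition total_leaves :: "nat \<Rightarrow> nat" where
  "total_leaves n = (\<Sum>(r, E)\<in>trees12 n. card (leaves {1..n} E))"

lemma finite_trees12: "finite (trees12 n)"
proof (rule finite_subset)
  show "trees12 n \<subseteq> {1..n} \<times> Pow ({1..n} \<times> {1..n})"
    by (auto simp: trees12_def rooted_tree_def)
qed auto

lemma total_leaves_0: "total_leaves 0 = 0"
  by (simp add: total_leaves_def leaves_def)

definition leaves_egf :: "real fps" where
  "leaves_egf = Abs_fps (\<lambda>n. of_nat (total_leaves n) / fact n)"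

end

theory Submission
  imports Defs "HOL-Computational_Algebra.Polynomial"
begin

text \<open>A tree on \<open>n + 1\<close> vertices arises from a tree on \<open>n\<close> vertices by attaching the vertex of
  smallest label to a leaf or to a vertex with one child. A tree with \<open>k\<close> leaves has
  \<open>n + 1 - 2k\<close> vertices with one child, so counting leaves by a variable \<open>x\<close> gives a linear first
  order PDE for the bivariate generating function \<open>F(z, x)\<close>. The PDE implies the Riccati equation
  \<open>F\<^sub>z = x + F + F\<^sup>2/2\<close>, without the need for a bijection that splits a tree at its root. At
  \<open>x = 1\<close> this gives \<open>1 + F = cos z / (1 - sin z)\<close>, and its \<open>x\<close>-derivative there is the linear
  equation \<open>A' = 1 + A(1 + F)\<close>, that is, \<open>(A(1 - sin z))' = 1 - sin z\<close>.\<close>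

unbundle fps_syntax

subsection \<open>Bivariate power series\<close>

text \<open>The coefficient of \<open>z^m\<close> expresses \<open>(m + 1) * W $ (m + 1)\<close>
  through \<open>W $ 0, ..., W $ m\<close>, and characteristic zero permits division by
  \<open>m + 1\<close>. As \<open>Y\<close> is arbitrary and may involve \<open>W\<close>, this also
  covers nonlinear equations.\<close>

lemma fps_eq_0_if_linear_ode:
  fixes W Y :: "'a::field_char_0 fps"
  assumes ode: "fps_deriv W = W * Y" and init: "W $ 0 = 0"
  shows "W = 0"
proof (rule fps_ext)
  fix n
  show "W $ n = 0 $ n"
  proof (induction n rule: less_induct)
    case (less n)
    show ?case
    proof (cases n)
      case 0
      then show ?thesis using init by simp
    next
      case (Suc m)
      have "(of_nat (Suc m) :: 'a) * W $ Suc m = (W * Y) $ m"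
        by (simp flip: ode)
      also have "\<dots> = 0"
        using less Suc by (simp add: fps_mult_nth)
      finally show ?thesis
        using Suc by (simp del: of_nat_Suc)
    qed
  qed
qed

text \<open>The partial derivative in the polynomial variable \<open>x\<close>, next to
  \<open>fps_deriv\<close> as the one in \<open>z\<close>.\<close>

definition fps_coeff_deriv :: "'a::idom poly fps \<Rightarrow> 'a poly fps" where
  "fps_coeff_deriv F = Abs_fps (\<lambda>n. pderiv (F $ n))"

lemma fps_coeff_deriv_nth [simp]: "fps_coeff_deriv F $ n = pderiv (F $ n)"
  by (simp add: fps_coeff_deriv_def)

lemma fps_coeff_deriv_add: "fps_coeff_deriv (F + G) = fps_coeff_deriv F + fps_coeff_deriv G"
  by (rule fps_ext) (simp add: pderiv_add)

lemma fps_coeff_deriv_diff: "fps_coeff_deriv (F - G) = fps_coeff_deriv F - fps_coeff_deriv G"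
  by (rule fps_ext) (simp add: pderiv_diff)

lemma fps_coeff_deriv_mult:
  "fps_coeff_deriv (F * G) = F * fps_coeff_deriv G + fps_coeff_deriv F * G"
proof (rule fps_ext)
  have "pderiv (F $ i * G $ j) = F $ i * pderiv (G $ j) + pderiv (F $ i) * G $ j" for i j
    by (simp add: pderiv_mult)
  then show "fps_coeff_deriv (F * G) $ n = (F * fps_coeff_deriv G + fps_coeff_deriv F * G) $ n" for n
    by (simp add: fps_mult_nth higher_pderiv_sum [of 1, simplified] sum.distrib)
qed

lemma fps_coeff_deriv_const: "fps_coeff_deriv (fps_const c) = fps_const (pderiv c)"
  by (rule fps_ext) simp

lemma fps_coeff_deriv_numeral: "fps_coeff_deriv (numeral k) = 0"
  by (simp add: numeral_fps_const numeral_poly fps_coeff_deriv_const pderiv_pCons)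

lemma fps_deriv_fps_coeff_deriv:
  "fps_deriv (fps_coeff_deriv F) = fps_coeff_deriv (fps_deriv F)"
  by (rule fps_ext) (simp add: pderiv_mult pderiv_of_nat flip: of_nat_Suc)

text \<open>Specialization \<open>x = a\<close>: it respects sums and products and commutes with
  \<open>fps_deriv\<close>, so differential equations in \<open>z\<close> carry over.\<close>

definition fps_poly_eval :: "'a::comm_ring_1 poly fps \<Rightarrow> 'a \<Rightarrow> 'a fps" where
  "fps_poly_eval F a = Abs_fps (\<lambda>n. poly (F $ n) a)"

lemma fps_poly_eval_nth [simp]: "fps_poly_eval F a $ n = poly (F $ n) a"
  by (simp add: fps_poly_eval_def)

lemma fps_poly_eval_add: "fps_poly_eval (F + G) a = fps_poly_eval F a + fps_poly_eval G a"
  by (rule fps_ext) simp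

lemma fps_poly_eval_mult: "fps_poly_eval (F * G) a = fps_poly_eval F a * fps_poly_eval G a"
  by (rule fps_ext) (simp add: fps_mult_nth poly_sum)

lemma fps_poly_eval_const: "fps_poly_eval (fps_const c) a = fps_const (poly c a)"
  by (rule fps_ext) simp

lemma fps_deriv_fps_poly_eval: "fps_deriv (fps_poly_eval F a) = fps_poly_eval (fps_deriv F) a"
  by (rule fps_ext) simp

text \<open>With \<open>x\<close> the polynomial variable, \<open>z\<close> the power series variable and
  \<open>L = (1 - xz) \<partial>\<^sub>z - x(1 - 2x) \<partial>\<^sub>x\<close>, the hypothesis reads \<open>L F = x(1 + F)\<close>. As
  \<open>L\<close> is a derivation with \<open>[L, \<partial>\<^sub>z] = x \<partial>\<^sub>z\<close>, the defect
  \<open>K = 2F\<^sub>z - 2x - 2F - F\<^sup>2\<close> satisfies \<open>L K = 2xK\<close>, which forces \<open>K = 0\<close>.\<close>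

lemma fps_riccati_if_pde:
  fixes F :: "'a::{idom,ring_char_0} poly fps"
  defines "x \<equiv> fps_const [:0, 1:]" and "D \<equiv> fps_coeff_deriv"
  assumes pde: "(1 - x * fps_X) * fps_deriv F = x + x * F + x * (1 - 2 * x) * D F"
    and init: "F $ 0 = 0"
  shows "2 * fps_deriv F = 2 * x + 2 * F + F * F"
proof -
  define K where "K = fps_deriv F + fps_deriv F - x - x - F - F - F * F"
  define G where "G = fps_deriv F"
  define H where "H = fps_deriv G"
  have Dx: "D x = 1"
    by (simp add: D_def x_def fps_coeff_deriv_const pderiv_pCons)
  have x': "fps_deriv x = 0"
    by (simp add: x_def)
  \<comment> \<open>The commutator appears here: differentiating \<open>1 - x * fps_X\<close> leaves
    \<open>- x * G\<close> on the left, which joins \<open>x * G\<close> on the right.\<close>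
  have "fps_deriv ((1 - x * fps_X) * G) = fps_deriv (x + x * F + x * (1 - 2 * x) * D F)"
    using pde by (simp add: G_def)
  then have G_pde: "(1 - x * fps_X) * H = 2 * x * G + x * (1 - 2 * x) * D G"
    by (simp add: x' H_def D_def fps_deriv_fps_coeff_deriv algebra_simps flip: G_def)
  have DK: "D K = D G + D G - 2 - D F - D F - 2 * F * D F"
    by (simp add: K_def D_def fps_coeff_deriv_diff fps_coeff_deriv_add fps_coeff_deriv_mult
        fps_coeff_deriv_numeral Dx [unfolded D_def] flip: G_def)
  have "(1 - x * fps_X) * fps_deriv K
      = 2 * ((1 - x * fps_X) * H) - 2 * (1 + F) * ((1 - x * fps_X) * G)"
    by (simp add: K_def x' flip: G_def) (simp add: algebra_simps H_def)
  also have "\<dots> = 2 * (2 * x * G + x * (1 - 2 * x) * D G)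
      - 2 * (1 + F) * (x + x * F + x * (1 - 2 * x) * D F)"
    using pde G_pde by (simp add: G_def)
  also have "\<dots> = x * (1 - 2 * x) * D K + 2 * x * K"
    unfolding DK by (simp add: K_def flip: G_def) (simp add: algebra_simps)
  \<comment> \<open>Isolating \<open>fps_deriv K\<close> makes \<open>(n + 1) * K $ (n + 1)\<close>
    depend on \<open>K $ n\<close> and its \<open>x\<close>-derivative only, so vanishing
    propagates.\<close>
  finally have "fps_deriv K = x * (fps_X * fps_deriv K) + x * ((1 - 2 * x) * D K + 2 * K)"
    by (simp add: algebra_simps)
  then have rec: "fps_deriv K $ n = (x * (fps_X * fps_deriv K)) $ n + (x * ((1 - 2 * x) * D K + 2 * K)) $ n"
    for n by (metis fps_add_nth)
  have two_x: "1 - 2 * x = fps_const [:1, -2:]"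
    by (rule fps_ext) (simp add: x_def numeral_fps_const numeral_poly one_pCons)
  have K_nth: "K $ n = 0" for n
  proof (induction n)
    case 0
    \<comment> \<open>At \<open>z = 0\<close> the PDE gives the value \<open>x\<close> for
      \<open>fps_deriv F\<close>, which cancels the \<open>- x - x\<close> in
      \<open>K\<close>.\<close>
    have "((1 - x * fps_X) * fps_deriv F) $ 0 = x $ 0"
      unfolding pde using init by (simp add: D_def)
    then have "fps_deriv F $ 0 = x $ 0"
      by simp
    then show ?case
      using init by (simp add: K_def)
  next
    case (Suc n)
    have "(of_nat (Suc n) :: 'a poly) * K $ Suc n = fps_deriv K $ n"
      by simp
    also have "\<dots> = 0"
      using Suc unfolding rec two_x
      by (cases n) (simp_all add: x_def D_def numeral_fps_const)
    finally show ?case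
      by (simp del: of_nat_Suc)
  qed
  have "K = 0"
    by (rule fps_ext) (simp add: K_nth)
  then show ?thesis
    by (simp add: K_def algebra_simps)
qed

subsection \<open>Counting leaves by insertion of a vertex\<close>

text \<open>Trees with the labels reversed, \<open>v\<close> becoming \<open>n - v\<close>: labels then increase away from
  the root \<open>0\<close>, so that a new vertex \<open>n\<close> can be attached without relabeling.\<close>

definition inc_trees :: "nat \<Rightarrow> (nat \<times> nat) set set" where
  "inc_trees n = {E. E \<subseteq> {(u, v). u < v \<and> v < n} \<and>
     (\<forall>v\<in>{0<..<n}. \<exists>!u. (u, v) \<in> E) \<and> (\<forall>u<n. card (E `` {u}) \<le> 2)}"

lemma inc_treesD:
  assumes "E \<in> inc_trees n"
  shows "(u, v) \<in> E \<Longrightarrow> u < v" and "(u, v) \<in> E \<Longrightarrow> v < n"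
    and "0 < v \<Longrightarrow> v < n \<Longrightarrow> \<exists>!u. (u, v) \<in> E"
    and "u < n \<Longrightarrow> card (E `` {u}) \<le> 2"
  using assms by (auto simp: inc_trees_def)

lemma inc_trees_subset:
  assumes "E \<in> inc_trees n"
  shows "E \<subseteq> {..<n} \<times> {..<n}"
proof (rule subrelI)
  fix u v
  assume "(u, v) \<in> E"
  then have "u < v" "v < n"
    using inc_treesD(1,2)[OF assms] by blast+
  then show "(u, v) \<in> {..<n} \<times> {..<n}"
    by simp
qed

lemma finite_inc_trees: "finite (inc_trees n)"
  by (rule finite_subset [of _ "Pow ({..<n} \<times> {..<n})"]) (auto dest: inc_trees_subset)

lemma finite_inc_tree: "E \<in> inc_trees n \<Longrightarrow> finite E"
  by (rule finite_subset [OF inc_trees_subset]) auto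

text \<open>An edge is determined by its child, and the children are exactly the vertices other than
  the root \<open>0\<close>.\<close>

lemma card_inc_tree:
  assumes "E \<in> inc_trees n" "n > 0"
  shows "card E = n - 1"
proof -
  have "bij_betw snd E {0<..<n}"
    unfolding bij_betw_def
  proof
    show "inj_on snd E"
    proof (rule inj_onI)
      fix e e'
      assume "e \<in> E" "e' \<in> E" "snd e = snd e'"
      then show "e = e'"
        using inc_treesD[OF assms(1)]
        by (cases e, cases e') (metis not_less_zero gr0I snd_conv)
    qed
    show "snd ` E = {0<..<n}"
    proof (intro equalityI subsetI)
      fix v
      assume "v \<in> snd ` E"
      then obtain u where "(u, v) \<in> E"
        by auto
      then have "u < v" "v < n"
        using inc_treesD(1,2)[OF assms(1)] by blast+
      then show "v \<in> {0<..<n}"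
        by simp
    next
      fix v
      assume "v \<in> {0<..<n}"
      then obtain u where "(u, v) \<in> E"
        using inc_treesD(3)[OF assms(1), of v] by auto
      then show "v \<in> snd ` E"
        by (rule rev_image_eqI) simp
    qed
  qed
  then have "card E = card {0<..<n}"
    by (rule bij_betw_same_card)
  then show ?thesis
    by simp
qed

text \<open>If \<open>U i\<close> is the set of vertices with \<open>i\<close> children, counting
  vertices gives \<open>|U 0| + |U 1| + |U 2| = n\<close> and counting edges gives
  \<open>|U 1| + 2 |U 2| = n - 1\<close>. Now eliminate \<open>|U 2|\<close>.\<close>

lemma card_unary_inc_tree:
  assumes E: "E \<in> inc_trees n" and n: "n > 0"
  shows "card {u. u < n \<and> card (E `` {u}) = 1} + 2 * card (leaves {..<n} E) = n + 1"
proof -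
  define U where "U i = {u. u < n \<and> card (E `` {u}) = i}" for i
  have fin: "finite (E `` {u})" for u
    using finite_inc_tree[OF E] by (simp add: finite_Image)
  have leaves_eq: "leaves {..<n} E = U 0"
    using fin by (auto simp: leaves_def U_def)
  have split: "{..<n} = U 0 \<union> U 1 \<union> U 2"
    using inc_treesD(4)[OF E] by (force simp: U_def le_Suc_eq numeral_2_eq_2)
  have finU: "finite (U i)" for i
    by (simp add: U_def)
  have disj: "U i \<inter> U j = {}" if "i \<noteq> j" for i j
    using that by (auto simp: U_def)
  have sum_split: "(\<Sum>u<n. f u) = sum f (U 0) + sum f (U 1) + sum f (U 2)" for f :: "nat \<Rightarrow> nat"
    unfolding split by (subst sum.union_disjoint, simp_all add: finU disj Int_Un_distrib2)+
  have "E = Sigma {..<n} (\<lambda>u. E `` {u})"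
    using inc_treesD(1,2)[OF E] by force
  then have "card E = card (Sigma {..<n} (\<lambda>u. E `` {u}))"
    by (rule arg_cong)
  also have "\<dots> = (\<Sum>u<n. card (E `` {u}))"
    using fin by (intro card_SigmaI) auto
  also have "\<dots> = card (U 1) + 2 * card (U 2)"
    unfolding sum_split by (simp add: U_def)
  finally have "n - 1 = card (U 1) + 2 * card (U 2)"
    using card_inc_tree[OF E n] by simp
  moreover have "n = card (U 0) + card (U 1) + card (U 2)"
    using sum_split[of "\<lambda>_. 1"] by simp
  ultimately have "card (U 1) + 2 * card (U 0) = n + 1"
    using n by linarith
  then show ?thesis
    unfolding leaves_eq U_def .
qed

text \<open>The largest label \<open>n\<close> has no children, so the edge into it can be removed
  and what remains is a tree; its parent \<open>u\<close> then has room for one more child.\<close>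

lemma inc_trees_Suc:
  assumes n: "n > 0"
  shows "bij_betw (\<lambda>(E, u). insert (u, n) E)
    (SIGMA E:inc_trees n. {u. u < n \<and> card (E `` {u}) < 2}) (inc_trees (Suc n))"
  (is "bij_betw ?f ?S _")
  unfolding bij_betw_def
proof
  have del: "E = {e \<in> insert (u, n) E. snd e \<noteq> n}" if "E \<in> inc_trees n" for E u
    using inc_treesD(2)[OF that, of _ n] by auto
  show "inj_on ?f ?S"
  proof (rule inj_onI, clarify)
    fix E u E' u'
    assume E: "E \<in> inc_trees n" "E' \<in> inc_trees n" and eq: "insert (u, n) E = insert (u', n) E'"
    have "E = E'"
      using del[OF E(1), of u] del[OF E(2), of u'] eq by simp
    moreover have "(u, n) \<notin> E" "(u', n) \<notin> E'"
      using inc_treesD(2) E by blast+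
    ultimately show "E = E' \<and> u = u'"
      using eq by blast
  qed
  show "?f ` ?S = inc_trees (Suc n)"
  proof (intro equalityI subsetI)
    fix E'
    assume "E' \<in> ?f ` ?S"
    then obtain E u where E: "E \<in> inc_trees n" and u: "u < n" "card (E `` {u}) < 2"
      and E': "E' = insert (u, n) E"
      by auto
    note D = inc_treesD[OF E]
    have img: "E' `` {w} = (if w = u then insert n (E `` {u}) else E `` {w})" for w
      by (auto simp: E')
    have "card (E' `` {w}) \<le> 2" if "w < Suc n" for w
    proof (cases "w = n")
      case True
      then have "E' `` {w} = {}"
        using D u by (fastforce simp: E')
      then show ?thesis by simp
    next
      case False
      then show ?thesis
        using that D(4)[of w] u card_insert_le_m1[of 2 "E `` {u}" n] by (auto simp: img)
    qed
    moreover have "\<exists>!w. (w, v) \<in> E'" if "0 < v" "v < Suc n" for v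
    proof (cases "v = n")
      case True
      then show ?thesis using D(2) by (auto simp: E')
    next
      case False
      then show ?thesis using D(3)[of v] that by (auto simp: E')
    qed
    ultimately show "E' \<in> inc_trees (Suc n)"
      using D u by (auto simp: inc_trees_def E' less_Suc_eq)
  next
    fix E'
    assume E': "E' \<in> inc_trees (Suc n)"
    note D = inc_treesD[OF E']
    obtain u where u: "(u, n) \<in> E'" and u_unique: "\<And>w. (w, n) \<in> E' \<Longrightarrow> w = u"
      using D(3)[of n] n by auto
    define E where "E = E' - {(u, n)}"
    have eq: "E' = insert (u, n) E"
      using u by (auto simp: E_def)
    have fin: "finite (E' `` {w})" for w
      using finite_inc_tree[OF E'] by (simp add: finite_Image)
    have "u < n"
      using D(1) u by blast
    have "card (E `` {u}) < card (E' `` {u})"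
      using u by (intro psubset_card_mono fin) (auto simp: E_def)
    also have "\<dots> \<le> 2"
      using D(4)[of u] \<open>u < n\<close> by simp
    finally have card_u: "card (E `` {u}) < 2" .
    have "card (E `` {w}) \<le> 2" if "w < n" for w
    proof -
      have "card (E `` {w}) \<le> card (E' `` {w})"
        using fin by (intro card_mono) (auto simp: E_def)
      then show ?thesis
        using D(4)[of w] that by simp
    qed
    moreover have "v < n" if "(w, v) \<in> E" for w v
      using D(2)[of w v] u_unique[of w] that by (cases "v = n") (auto simp: E_def)
    moreover have "\<exists>!w. (w, v) \<in> E" if "0 < v" "v < n" for v
      using D(3)[of v] that by (auto simp: E_def)
    ultimately have "E \<in> inc_trees n"
      using D(1) by (auto simp: inc_trees_def E_def)
    then have "(E, u) \<in> ?S"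
      using \<open>u < n\<close> card_u by simp
    then show "E' \<in> ?f ` ?S"
      by (rule rev_image_eqI) (simp add: eq)
  qed
qed

text \<open>The new vertex \<open>n\<close> is a leaf, and \<open>u\<close> is no longer one: a leaf
  is replaced or one is gained.\<close>

lemma card_leaves_insert:
  assumes E: "E \<in> inc_trees n" and u: "u < n"
  shows "card (leaves {..<Suc n} (insert (u, n) E)) =
    (if E `` {u} = {} then card (leaves {..<n} E) else Suc (card (leaves {..<n} E)))"
proof -
  have "E `` {n} = {}"
    using inc_treesD(1,2)[OF E] by fastforce
  then have "leaves {..<Suc n} (insert (u, n) E) = insert n (leaves {..<n} E - {u})"
    using u by (auto simp: leaves_def less_Suc_eq)
  moreover have "finite (leaves {..<n} E)" "n \<notin> leaves {..<n} E"
    by (auto simp: leaves_def)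
  moreover have "u \<in> leaves {..<n} E \<longleftrightarrow> E `` {u} = {}"
    using u by (auto simp: leaves_def)
  \<comment> \<open>Needed for \<open>Suc (card L - 1) = card L\<close> under truncated subtraction,
    where \<open>L\<close> is the old set of leaves.\<close>
  moreover have "0 < card (leaves {..<n} E)" if "u \<in> leaves {..<n} E"
    using that by (auto simp: leaves_def card_gt_0_iff)
  ultimately show ?thesis
    by auto
qed

definition leaf_poly :: "nat \<Rightarrow> real poly" where
  "leaf_poly n = (\<Sum>E\<in>inc_trees n. monom 1 (card (leaves {..<n} E)))"

lemma leaf_poly_1: "leaf_poly (Suc 0) = [:0, 1:]"
proof -
  have "inc_trees (Suc 0) = {{}}"
    by (auto simp: inc_trees_def)
  then show ?thesis
    by (simp add: leaf_poly_def leaves_def monom_Suc)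
qed

text \<open>A tree with \<open>k\<close> leaves has \<open>k\<close> extensions with
  \<open>k\<close> leaves and \<open>n + 1 - 2k\<close> with \<open>k + 1\<close>. The resulting
  \<open>k x^k + (n + 1 - 2k) x^(k+1)\<close> becomes linear in \<open>x^k\<close> and its
  derivative by \<open>k x^k = x (x^k)'\<close>.\<close>

lemma leaf_poly_Suc:
  assumes n: "n > 0"
  shows "leaf_poly (Suc n) =
    of_nat (Suc n) * [:0, 1:] * leaf_poly n + [:0, 1:] * [:1, -2:] * pderiv (leaf_poly n)"
proof -
  define x :: "real poly" where "x = [:0, 1:]"
  have monom_eq: "monom 1 k = x ^ k" for k
    by (simp add: x_def monom_altdef)
  have "pderiv x = 1"
    by (simp add: x_def pderiv_pCons)
  then have x': "x * pderiv (x ^ k) = of_nat k * x ^ k" for k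
    by (cases k) (simp_all add: pderiv_power_Suc of_nat_poly del: of_nat_Suc power_Suc, simp)
  have two: "[:1, -2:] = 1 - 2 * x"
    by (simp add: x_def numeral_poly one_pCons)
  define k where "k E = card (leaves {..<n} E)" for E
  have step: "(\<Sum>u\<in>{u. u < n \<and> card (E `` {u}) < 2}.
        x ^ card (leaves {..<Suc n} (insert (u, n) E)))
      = of_nat (Suc n) * x * x ^ k E + x * (1 - 2 * x) * pderiv (x ^ k E)"
    if E: "E \<in> inc_trees n" for E
  proof -
    define U where "U = {u. u < n \<and> card (E `` {u}) = 1}"
    have fin: "finite (E `` {u})" for u
      using finite_inc_tree[OF E] by (simp add: finite_Image)
    have "{u. u < n \<and> card (E `` {u}) < 2} = leaves {..<n} E \<union> U"
      using fin by (auto simp: leaves_def U_def less_2_cases_iff)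
    moreover have "leaves {..<n} E \<inter> U = {}"
      by (auto simp: leaves_def U_def)
    moreover have "finite (leaves {..<n} E)" "finite U"
      by (auto simp: leaves_def U_def)
    ultimately have "(\<Sum>u\<in>{u. u < n \<and> card (E `` {u}) < 2}.
          x ^ card (leaves {..<Suc n} (insert (u, n) E)))
        = (\<Sum>u\<in>leaves {..<n} E. x ^ card (leaves {..<Suc n} (insert (u, n) E)))
        + (\<Sum>u\<in>U. x ^ card (leaves {..<Suc n} (insert (u, n) E)))"
      by (simp add: sum.union_disjoint)
    also have "(\<Sum>u\<in>leaves {..<n} E. x ^ card (leaves {..<Suc n} (insert (u, n) E)))
        = (\<Sum>u\<in>leaves {..<n} E. x ^ k E)"
      by (rule sum.cong [OF refl], subst card_leaves_insert[OF E]) (auto simp: k_def leaves_def)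
    also have "(\<Sum>u\<in>U. x ^ card (leaves {..<Suc n} (insert (u, n) E))) = (\<Sum>u\<in>U. x ^ Suc (k E))"
      by (rule sum.cong) (auto simp: card_leaves_insert[OF E] k_def U_def)
    finally have sum_eq: "(\<Sum>u\<in>{u. u < n \<and> card (E `` {u}) < 2}.
          x ^ card (leaves {..<Suc n} (insert (u, n) E)))
        = of_nat (k E) * x ^ k E + of_nat (card U) * (x * x ^ k E)"
      by (simp add: k_def)
    have "card U + 2 * k E = Suc n"
      using card_unary_inc_tree[OF E n] by (simp add: U_def k_def)
    then have "(of_nat (Suc n) :: real poly) = of_nat (card U) + 2 * of_nat (k E)"
      by (metis of_nat_add of_nat_mult of_nat_numeral)
    moreover have "x * (1 - 2 * x) * pderiv (x ^ k E) = (1 - 2 * x) * (of_nat (k E) * x ^ k E)"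
      by (simp flip: x')
    ultimately show ?thesis
      unfolding sum_eq by (simp add: algebra_simps)
  qed
  have "leaf_poly (Suc n) = (\<Sum>(E, u)\<in>(SIGMA E:inc_trees n. {u. u < n \<and> card (E `` {u}) < 2}).
      x ^ card (leaves {..<Suc n} (insert (u, n) E)))"
    unfolding leaf_poly_def monom_eq sum.reindex_bij_betw[OF inc_trees_Suc[OF n], symmetric]
    by (simp add: case_prod_unfold)
  also have "\<dots> = (\<Sum>E\<in>inc_trees n. \<Sum>u\<in>{u. u < n \<and> card (E `` {u}) < 2}.
      x ^ card (leaves {..<Suc n} (insert (u, n) E)))"
    by (rule sum.Sigma [symmetric]) (auto simp: finite_inc_trees)
  also have "\<dots> = (\<Sum>E\<in>inc_trees n.
      of_nat (Suc n) * x * x ^ k E + x * (1 - 2 * x) * pderiv (x ^ k E))"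
    by (rule sum.cong) (simp_all only: step)
  also have "\<dots> = of_nat (Suc n) * x * leaf_poly n + x * (1 - 2 * x) * pderiv (leaf_poly n)"
    unfolding leaf_poly_def monom_eq higher_pderiv_sum [of 1, simplified]
    by (simp only: sum.distrib sum_distrib_left k_def)
  finally show ?thesis
    by (simp only: two flip: x_def)
qed

subsection \<open>Reversal of the labels\<close>

text \<open>Otherwise the vertex \<open>n\<close> would have a parent with a label above
  \<open>n\<close>.\<close>

lemma trees12_root:
  assumes "(r, E) \<in> trees12 n"
  shows "r = n"
proof (rule ccontr)
  assume "r \<noteq> n"
  have T: "rooted_tree {1..n} r E" "\<forall>(u, v)\<in>E. v < u"
    using assms by (auto simp: trees12_def)
  then have "n \<in> {1..n} - {r}"
    using \<open>r \<noteq> n\<close> by (auto simp: rooted_tree_def)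
  then obtain u where "(u, n) \<in> E"
    using T(1) unfolding rooted_tree_def by blast
  then show False
    using T by (fastforce simp: rooted_tree_def)
qed

text \<open>Reachability from the root is automatic: labels strictly increase from child to parent,
  so the chain of parents can only end at \<open>n\<close>.\<close>

lemma trees12_iff:
  assumes n: "n > 0"
  shows "(n, E) \<in> trees12 n \<longleftrightarrow> E \<subseteq> {(u, v). 0 < v \<and> v < u \<and> u \<le> n} \<and>
    (\<forall>v\<in>{0<..<n}. \<exists>!u. (u, v) \<in> E) \<and> (\<forall>u\<in>{1..n}. card (E `` {u}) \<le> 2)"
  (is "?L \<longleftrightarrow> ?R")
proof
  assume ?L
  then have T: "E \<subseteq> {1..n} \<times> {1..n}" "\<forall>v\<in>{1..n} - {n}. \<exists>!u. (u, v) \<in> E"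
      "\<forall>u\<in>{1..n}. card (E `` {u}) \<le> 2" "\<forall>(u, v)\<in>E. v < u"
    by (simp_all add: trees12_def rooted_tree_def)
  show ?R
  proof (intro conjI)
    show "E \<subseteq> {(u, v). 0 < v \<and> v < u \<and> u \<le> n}"
      using T(1,4) by fastforce
    show "\<forall>v\<in>{0<..<n}. \<exists>!u. (u, v) \<in> E"
      using T(2) by simp
  qed (rule T(3))
next
  assume ?R
  then have edge: "\<And>u v. (u, v) \<in> E \<Longrightarrow> 0 < v \<and> v < u \<and> u \<le> n"
    and parent: "\<And>v. 0 < v \<Longrightarrow> v < n \<Longrightarrow> \<exists>!u. (u, v) \<in> E"
    and card: "\<And>u. u \<in> {1..n} \<Longrightarrow> card (E `` {u}) \<le> 2"
    by auto
  have reach: "0 < v \<Longrightarrow> v \<le> n \<Longrightarrow> (n, v) \<in> E\<^sup>*" for v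
  proof (induction "n - v" arbitrary: v rule: less_induct)
    case less
    show ?case
    proof (cases "v = n")
      case False
      then obtain u where u: "(u, v) \<in> E"
        using parent[of v] less.prems by auto
      then have "(n, u) \<in> E\<^sup>*"
        using edge[OF u] by (intro less.hyps) auto
      then show ?thesis
        using u by (rule rtrancl_into_rtrancl)
    qed simp
  qed
  have "rooted_tree {1..n} n E"
    unfolding rooted_tree_def
  proof (intro conjI ballI allI)
    show "E \<subseteq> {1..n} \<times> {1..n}"
      using edge by fastforce
    show "(u, n) \<notin> E" for u
      using edge[of u n] by auto
    show "\<exists>!u. (u, v) \<in> E" if "v \<in> {1..n} - {n}" for v
      using that by (intro parent) auto
  qed (use n reach in auto)
  then show ?L
    using edge card by (auto simp: trees12_def)
qed

text \<open>The bounds keep truncated subtraction involutive. Working in \<open>{..n}\<close> lets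
  one map serve both directions between \<open>{..<n}\<close> and \<open>{1..n}\<close>.\<close>

definition flip :: "nat \<Rightarrow> (nat \<times> nat) set \<Rightarrow> (nat \<times> nat) set" where
  "flip n E = {(u, v). u \<le> n \<and> v \<le> n \<and> (n - u, n - v) \<in> E}"

lemma flip_flip: "E \<subseteq> {..n} \<times> {..n} \<Longrightarrow> flip n (flip n E) = E"
  by (auto simp: flip_def)

lemma flip_Image:
  assumes "E \<subseteq> {..n} \<times> {..n}" "u \<le> n"
  shows "flip n E `` {u} = (\<lambda>v. n - v) ` (E `` {n - u})"
proof (intro equalityI subsetI)
  fix w
  assume "w \<in> flip n E `` {u}"
  then have "w = n - (n - w)" "n - w \<in> E `` {n - u}"
    by (auto simp: flip_def)
  then show "w \<in> (\<lambda>v. n - v) ` (E `` {n - u})"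
    by (rule image_eqI)
next
  fix w
  assume "w \<in> (\<lambda>v. n - v) ` (E `` {n - u})"
  then obtain v where "w = n - v" "(n - u, v) \<in> E"
    by auto
  moreover from this have "v \<le> n"
    using assms(1) by auto
  ultimately show "w \<in> flip n E `` {u}"
    using assms(2) by (simp add: flip_def)
qed

lemma card_flip_Image:
  assumes "E \<subseteq> {..n} \<times> {..n}" "u \<le> n"
  shows "card (flip n E `` {u}) = card (E `` {n - u})"
proof -
  have "inj_on (\<lambda>v. n - v) {..n}"
    by (auto intro!: inj_onI)
  moreover have "E `` {n - u} \<subseteq> {..n}"
    using assms by auto
  ultimately show ?thesis
    unfolding flip_Image[OF assms] by (metis card_image inj_on_subset)
qed

lemma ex1_parent_flip:
  assumes "E \<subseteq> {..n} \<times> {..n}" "v \<le> n" "\<exists>!u. (u, n - v) \<in> E"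
  shows "\<exists>!u. (u, v) \<in> flip n E"
proof -
  obtain u where u: "(u, n - v) \<in> E" "\<And>w. (w, n - v) \<in> E \<Longrightarrow> w = u"
    using assms(3) by (elim ex1E) blast
  have "u \<le> n"
    using assms(1) u(1) by auto
  show ?thesis
  proof (rule ex1I)
    show "(n - u, v) \<in> flip n E"
      using u(1) \<open>u \<le> n\<close> assms(2) by (simp add: flip_def)
    show "w = n - u" if "(w, v) \<in> flip n E" for w
      using that u(2)[of "n - w"] by (auto simp: flip_def)
  qed
qed

lemma inc_trees_subset_atMost: "E \<in> inc_trees n \<Longrightarrow> E \<subseteq> {..n} \<times> {..n}"
  by (rule subset_trans [OF inc_trees_subset]) auto

lemma bij_betw_trees12:
  assumes n: "n > 0"
  shows "bij_betw (\<lambda>E. (n, flip n E)) (inc_trees n) (trees12 n)"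
proof (rule bij_betw_byWitness [where f' = "\<lambda>(r, E). flip n E"])
  have sub: "E \<subseteq> {..n} \<times> {..n}" if "(n, E) \<in> trees12 n" for E
    using that unfolding trees12_iff[OF n] by fastforce
  show "\<forall>E\<in>inc_trees n. (case (n, flip n E) of (r, E) \<Rightarrow> flip n E) = E"
    by (simp add: flip_flip inc_trees_subset_atMost)
  show "\<forall>t\<in>trees12 n. (n, flip n (case t of (r, E) \<Rightarrow> flip n E)) = t"
  proof
    fix t
    assume t: "t \<in> trees12 n"
    then obtain E where "t = (n, E)"
      using trees12_root by (cases t) blast
    then show "(n, flip n (case t of (r, E) \<Rightarrow> flip n E)) = t"
      using t sub by (simp add: flip_flip)
  qed
  show "(\<lambda>E. (n, flip n E)) ` inc_trees n \<subseteq> trees12 n"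
  proof (rule image_subsetI)
    fix E
    assume E: "E \<in> inc_trees n"
    note D = inc_treesD[OF E] and sub = inc_trees_subset_atMost[OF E]
    have "0 < v \<and> v < u \<and> u \<le> n" if "(u, v) \<in> flip n E" for u v
      using that D(1,2)[of "n - u" "n - v"] by (auto simp: flip_def)
    moreover have "\<exists>!u. (u, v) \<in> flip n E" if "v \<in> {0<..<n}" for v
      using that D(3)[of "n - v"] by (intro ex1_parent_flip[OF sub]) auto
    moreover have "card (flip n E `` {u}) \<le> 2" if "u \<in> {1..n}" for u
      using that D(4)[of "n - u"] by (simp add: card_flip_Image[OF sub])
    ultimately show "(n, flip n E) \<in> trees12 n"
      unfolding trees12_iff[OF n] by auto
  qed
  show "(\<lambda>(r, E). flip n E) ` trees12 n \<subseteq> inc_trees n"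
  proof clarify
    fix r E
    assume "(r, E) \<in> trees12 n"
    then have E: "(n, E) \<in> trees12 n"
      using trees12_root by blast
    note D = E[unfolded trees12_iff[OF n]] and sub = sub[OF E]
    have "u < v \<and> v < n" if "(u, v) \<in> flip n E" for u v
      using that D by (auto simp: flip_def)
    moreover have "\<exists>!u. (u, v) \<in> flip n E" if "v \<in> {0<..<n}" for v
      using that D by (intro ex1_parent_flip[OF sub]) auto
    moreover have "card (flip n E `` {u}) \<le> 2" if "u < n" for u
      using that D by (simp add: card_flip_Image[OF sub])
    ultimately show "flip n E \<in> inc_trees n"
      unfolding inc_trees_def by auto
  qed
qed

lemma card_leaves_flip:
  assumes "E \<in> inc_trees n"
  shows "card (leaves {1..n} (flip n E)) = card (leaves {..<n} E)"
proof -
  have empty: "flip n E `` {u} = {} \<longleftrightarrow> E `` {n - u} = {}" if "u \<le> n" for u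
    by (simp add: flip_Image[OF inc_trees_subset_atMost[OF assms] that])
  then have leaves_flip:
    "leaves {1..n} (flip n E) = {u. 1 \<le> u \<and> u \<le> n \<and> E `` {n - u} = {}}"
    by (simp add: leaves_def cong: conj_cong)
  have "bij_betw (\<lambda>v. n - v) (leaves {1..n} (flip n E)) (leaves {..<n} E)"
    unfolding leaves_flip
    by (rule bij_betw_byWitness [where f' = "\<lambda>v. n - v"]) (auto simp: leaves_def)
  then show ?thesis
    by (rule bij_betw_same_card)
qed

text \<open>The derivative of \<open>x^k\<close> at \<open>x = 1\<close> is \<open>k\<close>, so
  each tree is weighted by its number of leaves.\<close>

lemma total_leaves_eq_pderiv:
  assumes "n > 0"
  shows "real (total_leaves n) = poly (pderiv (leaf_poly n)) 1"
proof -
  have "total_leaves n = (\<Sum>E\<in>inc_trees n. card (leaves {..<n} E))"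
    unfolding total_leaves_def sum.reindex_bij_betw[OF bij_betw_trees12[OF assms], symmetric]
    by (simp add: card_leaves_flip del: One_nat_def)
  then show ?thesis
    by (simp add: leaf_poly_def higher_pderiv_sum [of 1, simplified] poly_sum pderiv_monom poly_monom)
qed

subsection \<open>Generating functions\<close>

text \<open>The constant term is set to \<open>0\<close> because \<open>leaf_poly 0\<close> is
  \<open>1\<close>: \<open>inc_trees 0\<close> contains the empty edge set, although there is no
  tree without vertices.\<close>

definition leaf_series :: "real poly fps" where
  "leaf_series = Abs_fps (\<lambda>n. if n = 0 then 0 else smult (1 / fact n) (leaf_poly n))"

text \<open>In the recurrence divided by \<open>n!\<close>, the factor \<open>n + 1\<close> splits
  into \<open>n\<close>, giving \<open>x z F_z\<close>, and \<open>1\<close>, giving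
  \<open>x F\<close>. The lone \<open>x\<close> is \<open>leaf_poly 1\<close>, which the recurrence
  does not reach.\<close>

lemma leaf_series_pde:
  defines "x \<equiv> fps_const [:0, 1:]"
  shows "(1 - x * fps_X) * fps_deriv leaf_series
    = x + x * leaf_series + x * (1 - 2 * x) * fps_coeff_deriv leaf_series"
proof (rule fps_ext)
  fix n
  have two_x: "x * (1 - 2 * x) = fps_const ([:0, 1:] * [:1, -2:])"
    by (rule fps_ext) (simp add: x_def numeral_fps_const numeral_poly one_pCons)
  have deriv: "fps_deriv leaf_series $ k = smult (1 / fact k) (leaf_poly (Suc k))" for k
    by (simp add: leaf_series_def of_nat_poly field_simps del: of_nat_Suc)
  have split: "((1 - x * fps_X) * fps_deriv leaf_series) $ n
      = fps_deriv leaf_series $ n - [:0, 1:] * (fps_X * fps_deriv leaf_series) $ n"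
    by (simp add: algebra_simps x_def)
  show "((1 - x * fps_X) * fps_deriv leaf_series) $ n
    = (x + x * leaf_series + x * (1 - 2 * x) * fps_coeff_deriv leaf_series) $ n"
  proof (cases n)
    case 0
    then show ?thesis
      unfolding split two_x deriv
      by (simp add: leaf_poly_1 x_def leaf_series_def)
  next
    case (Suc m)
    then have "n > 0"
      by simp
    have "(fps_X * fps_deriv leaf_series) $ n = smult (of_nat n / fact n) (leaf_poly n)"
      using Suc by (simp add: deriv del: fps_deriv_nth)
    moreover have "(x + x * leaf_series + x * (1 - 2 * x) * fps_coeff_deriv leaf_series) $ n
        = [:0, 1:] * smult (1 / fact n) (leaf_poly n)
          + [:0, 1:] * [:1, -2:] * smult (1 / fact n) (pderiv (leaf_poly n))"
      unfolding two_x using Suc by (simp add: x_def leaf_series_def pderiv_smult del: fact_Suc)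
    moreover have "leaf_poly (Suc n) = smult (of_nat n) ([:0, 1:] * leaf_poly n)
        + [:0, 1:] * leaf_poly n + [:0, 1:] * [:1, -2:] * pderiv (leaf_poly n)"
      using leaf_poly_Suc[of n] \<open>n > 0\<close> by (simp add: of_nat_poly smult_add_left algebra_simps)
    ultimately show ?thesis
      unfolding split deriv by (simp add: smult_add_right)
  qed
qed

text \<open>The solution is \<open>sec z + tan z\<close>: the difference \<open>W = S(1 - sin z) - cos z\<close> satisfies
  \<open>2(1 - sin z) W' = W\<^sup>2\<close> and so vanishes.\<close>

lemma fps_riccati_sec_tan:
  fixes S :: "real fps"
  assumes ode: "2 * fps_deriv S = 1 + S * S" and init: "S $ 0 = 1"
  shows "S * (1 - fps_sin 1) = fps_cos 1"
proof -
  define s c :: "real fps" where "s = fps_sin 1" and "c = fps_cos 1"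
  have s': "fps_deriv s = c" and c': "fps_deriv c = - s"
    by (simp_all add: s_def c_def fps_sin_deriv fps_cos_deriv flip: fps_const_neg)
  have sc: "c * c = 1 - s * s"
    using fps_sin_cos_sum_of_squares[of "1::real"]
    by (simp add: s_def c_def power2_eq_square algebra_simps)
  define W where "W = S * (1 - s) - c"
  have "2 * (1 - s) * fps_deriv W = (1 - s) * ((2 * fps_deriv S) * (1 - s) - 2 * S * c + 2 * s)"
    by (simp add: W_def s' c' algebra_simps)
  also have "\<dots> = (1 - s) * ((1 + S * S) * (1 - s) - 2 * S * c + 2 * s)"
    by (simp only: ode)
  also have "\<dots> = W * W + (1 - s * s - c * c)"
    by (simp add: W_def algebra_simps)
  finally have W: "2 * (1 - s) * fps_deriv W = W * W"
    by (simp add: sc)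
  \<comment> \<open>The constant term \<open>2\<close> makes \<open>2 * (1 - s)\<close> invertible,
    so the equation takes the form \<open>W' = W * Y\<close> with \<open>Y\<close> itself a multiple
    of \<open>W\<close>.\<close>
  have "(2 * (1 - s)) $ 0 \<noteq> 0"
    by (simp add: s_def numeral_fps_const)
  then have inv: "inverse (2 * (1 - s)) * (2 * (1 - s)) = 1"
    by (rule inverse_mult_eq_1)
  have "fps_deriv W = inverse (2 * (1 - s)) * (2 * (1 - s)) * fps_deriv W"
    unfolding inv by simp
  also have "\<dots> = inverse (2 * (1 - s)) * (W * W)"
    by (simp only: mult.assoc flip: W)
  also have "\<dots> = W * (W * inverse (2 * (1 - s)))"
    by (simp only: mult_ac)
  finally have "W = 0"
    by (rule fps_eq_0_if_linear_ode) (simp add: W_def s_def c_def init)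
  then show ?thesis
    by (simp add: W_def s_def c_def)
qed

theorem theorem2p2:
  shows "leaves_egf = (fps_X - 1 + fps_cos 1) / (1 - fps_sin 1)"
proof -
  define A E s c :: "real fps" where "A = fps_poly_eval (fps_coeff_deriv leaf_series) 1"
    and "E = fps_poly_eval leaf_series 1" and "s = fps_sin 1" and "c = fps_cos 1"
  define x :: "real poly fps" where "x = fps_const [:0, 1:]"
  note eval_simps = fps_poly_eval_add fps_poly_eval_mult fps_poly_eval_const
  have init: "leaf_series $ 0 = 0"
    by (simp add: leaf_series_def)
  have A: "leaves_egf = A"
  proof (rule fps_ext)
    fix n
    show "leaves_egf $ n = A $ n"
      using total_leaves_eq_pderiv[of n]
      by (cases "n = 0") (simp_all add: leaves_egf_def A_def leaf_series_def total_leaves_0 pderiv_smult)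
  qed
  have riccati: "2 * fps_deriv leaf_series = 2 * x + 2 * leaf_series + leaf_series * leaf_series"
    unfolding x_def by (rule fps_riccati_if_pde[OF leaf_series_pde init])
  have two: "(2 :: real poly fps) = fps_const 2"
    by (simp add: numeral_fps_const)
  have "2 * fps_deriv E = 2 + 2 * E + E * E"
    using arg_cong[OF riccati, of "\<lambda>F. fps_poly_eval F 1"]
    by (simp add: two x_def eval_simps E_def fps_deriv_fps_poly_eval) (simp add: numeral_fps_const)
  \<comment> \<open>Completing the square: \<open>2 + 2 * E + E * E\<close> is
    \<open>1 + (1 + E) * (1 + E)\<close>.\<close>
  then have "2 * fps_deriv (1 + E) = 1 + (1 + E) * (1 + E)"
    by (simp add: algebra_simps)
  then have cos_eq: "(1 + E) * (1 - s) = c"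
    unfolding s_def c_def by (rule fps_riccati_sec_tan) (simp add: E_def init)
  \<comment> \<open>The Riccati equation is differentiated in \<open>x\<close> before setting
    \<open>x = 1\<close>.\<close>
  have "2 * fps_deriv A = 2 * (1 + A + E * A)"
    using arg_cong[OF riccati, of "\<lambda>F. fps_poly_eval (fps_coeff_deriv F) 1"]
    by (simp add: two x_def eval_simps E_def A_def fps_deriv_fps_poly_eval fps_deriv_fps_coeff_deriv
        fps_coeff_deriv_add fps_coeff_deriv_mult fps_coeff_deriv_const pderiv_pCons)
       (simp add: numeral_fps_const algebra_simps)
  then have A': "fps_deriv A = 1 + A * (1 + E)"
    by (simp only: mult_cancel_left) (simp add: algebra_simps)
  \<comment> \<open>\<open>1 - s\<close> is an integrating factor: by \<open>cos_eq\<close> the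
    terms containing \<open>A\<close> cancel.\<close>
  have "fps_deriv (A * (1 - s)) = (1 + A * (1 + E)) * (1 - s) - A * c"
    by (simp add: A' s_def c_def fps_sin_deriv)
  also have "\<dots> = (1 - s) + A * ((1 + E) * (1 - s)) - A * c"
    by (simp add: algebra_simps)
  also have "\<dots> = fps_deriv (fps_X - 1 + c)"
    by (simp add: cos_eq) (simp add: s_def c_def fps_cos_deriv flip: fps_const_neg)
  \<comment> \<open>The constant of integration is zero, as both sides vanish at
    \<open>z = 0\<close>.\<close>
  finally have "A * (1 - s) = fps_X - 1 + c"
    by (subst (asm) fps_deriv_eq_iff) (simp add: A_def c_def init)
  moreover have "(1 - s) $ 0 \<noteq> 0"
    by (simp add: s_def)
  then have "1 - s \<noteq> 0"
    by (metis fps_zero_nth)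
  ultimately show ?thesis
    unfolding A by (metis c_def s_def nonzero_mult_div_cancel_right)
qed

end
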